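(* Let $\mathcal S_1$ be a disk of radius $R_1$ in the ground plane and $\mathcal S_2\subset\mathcal S_1$ a disk of radius $R_2>0$ whose center is at distance $d>0$ from the center of $\mathcal S_1$, with $d+R_2\le R_1$. Let a point (the aerial base station) be located at height $h>0$ above the center of $\mathcal S_2$, and let a user be uniformly distributed in $\mathcal S_1\setminus\mathcal S_2$. Then the 3-D Euclidean distance $Z_T$ between the aerial base station and the user has probability density function $$f_{Z_T}(z)=\begin{cases}\dfrac{2z}{R_1^2-R_2^2}, & \sqrt{R_2^2+h^2}\le z\le\sqrt{(R_1-d)^2+h^2},\\[2mm] \dfrac{2z\,\widehat\omega}{\pi(R_1^2-R_2^2)}, & \sqrt{(R_1-d)^2+h^2}<z\le\sqrt{(R_1+d)^2+h^2},\end{cases}$$ (and $0$ elsewhere), where $\widehat\omega=\widehat\omega(z)=\mathrm{arcsec}\left(\dfrac{2d\sqrt{z^2-h^2}}{d^2+z^2-h^2-R_1^2}\right)$.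
   Context: The ground plane is a plane in $\mathbb R^3$; height is measured perpendicularly to it. Convention: $\mathrm{arcsec}(x)=\arccos(1/x)\in[0,\pi]$, with $\mathrm{arcsec}(2dr/0)=\pi/2$. *)

theory Defs
  imports "HOL-Probability.Probability"
begin

text \<open>
  For an affine plane \<open>G\<close>, a plane isometry is a distance-preserving bijection from the coordinate
  plane onto \<open>G\<close>, that is, a choice of Cartesian coordinates on \<open>G\<close>.
\<close>

definition plane_isometry :: "(real^2 \<Rightarrow> real^3) \<Rightarrow> (real^3) set \<Rightarrow> bool" where
  "plane_isometry \<phi> G \<longleftrightarrow> (\<forall>x y. dist (\<phi> x) (\<phi> y) = dist x y) \<and> range \<phi> = G"

text \<open>
  The area measure of \<open>G\<close>, as a measure on the Borel sets of the ambient space: planar Lebesgue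
  measure in Cartesian coordinates on \<open>G\<close>. The coordinates exist for every plane
  (\<open>plane_isometry_exists\<close>) and their choice is immaterial (\<open>plane_area_eq\<close>).
\<close>

definition plane_area :: "(real^3) set \<Rightarrow> (real^3) measure" where
  "plane_area G = distr lborel borel (SOME \<phi>. plane_isometry \<phi> G)"

definition disk_in :: "(real^3) set \<Rightarrow> real^3 \<Rightarrow> real \<Rightarrow> (real^3) set" where
  "disk_in G c R = {x \<in> G. dist c x \<le> R}"

definition uniformly_distributed_in_plane ::
    "'m measure \<Rightarrow> (real^3) set \<Rightarrow> ('m \<Rightarrow> real^3) \<Rightarrow> (real^3) set \<Rightarrow> bool" where
  "uniformly_distributed_in_plane M G U A \<longleftrightarrow>
     U \<in> borel_measurable M \<and> distr M borel U = uniform_measure (plane_area G) A"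

text \<open>
  With \<open>x / 0 = 0\<close> we have \<open>arcsec (a / 0) = arcsec 0 = arccos 0 = pi / 2\<close>, which is the intended
  convention for a vanishing denominator.
\<close>

definition arcsec :: "real \<Rightarrow> real" where
  "arcsec x = arccos (1 / x)"

definition omega_hat :: "real \<Rightarrow> real \<Rightarrow> real \<Rightarrow> real \<Rightarrow> real" where
  "omega_hat R1 d h z = arcsec (2 * d * sqrt (z\<^sup>2 - h\<^sup>2) / (d\<^sup>2 + z\<^sup>2 - h\<^sup>2 - R1\<^sup>2))"

lemma plane_isometry_exists:
  assumes "affine G" "aff_dim G = 2"
  shows "\<exists>\<phi>. plane_isometry \<phi> G"
proof -
  obtain a where a: "a \<in> G"
    using assms by fastforce
  define V where "V = (\<lambda>x. - a + x) ` G"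
  have V: "subspace V"
    unfolding V_def using affine_diffs_subspace[OF assms(1) a] by simp
  have "int (dim V) = aff_dim G"
    using aff_dim_eq_dim[of a G] a unfolding V_def by (simp add: hull_inc)
  then have "dim V = 2" using assms by simp
  then obtain f :: "real^2 \<Rightarrow> real^3"
    where f: "linear f" "f ` UNIV = V" "\<And>x. norm (f x) = norm x"
    using isometry_subspaces[of "UNIV :: (real^2) set" V] V by auto
  have "range (\<lambda>x. a + f x) = (+) a ` V"
    using f(2) by (auto simp: image_iff)
  also have "\<dots> = G"
    by (simp add: V_def image_image)
  finally have "range (\<lambda>x. a + f x) = G" .
  moreover have "dist (a + f x) (a + f y) = dist x y" for x y
    using f(1,3) by (simp add: dist_norm flip: linear_diff)
  ultimately have "plane_isometry (\<lambda>x. a + f x) G"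
    unfolding plane_isometry_def by simp
  then show ?thesis
    by (intro exI[of _ "\<lambda>x. a + f x"])
qed

lemma distr_lborel_orthogonal_transformation:
  fixes L :: "real^2 \<Rightarrow> real^2"
  assumes L: "orthogonal_transformation L"
  shows "distr lborel borel L = lborel"
proof (rule lborel_eqI[symmetric])
  have meas: "L \<in> borel_measurable lborel"
    using L by (auto intro!: borel_measurable_continuous_onI linear_continuous_on
        simp: orthogonal_transformation_linear linear_linear)
  fix l u :: "real^2"
  assume lu: "\<And>b. b \<in> Basis \<Longrightarrow> l \<bullet> b \<le> u \<bullet> b"
  have iL: "orthogonal_transformation (inv L)"
    using L by (rule orthogonal_transformation_inv)
  have vim: "L -` box l u = inv L ` box l u"
    using bij_vimage_eq_inv_image[OF orthogonal_transformation_bij[OF L]] .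
  have lm: "inv L ` box l u \<in> lmeasurable"
    using measurable_orthogonal_image[OF iL] by simp
  have bor: "L -` box l u \<in> sets borel"
    using measurable_sets[OF meas, of "box l u"] by simp
  have "emeasure (distr lborel borel L) (box l u) = emeasure lborel (L -` box l u)"
    using meas by (simp add: emeasure_distr)
  also have "\<dots> = emeasure lebesgue (inv L ` box l u)"
    using bor vim by simp
  also have "\<dots> = measure lebesgue (inv L ` box l u)"
    using lm by (simp add: emeasure_eq_measure2)
  also have "\<dots> = measure lebesgue (box l u)"
    using measure_orthogonal_image[OF iL] by simp
  also have "\<dots> = (\<Prod>b\<in>Basis. (u - l) \<bullet> b)"
    using lu by (simp add: measure_lborel_box_eq)
  finally show "emeasure (distr lborel borel L) (box l u) = (\<Prod>b\<in>Basis. (u - l) \<bullet> b)" .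
qed simp

lemma plane_isometry_measurable:
  assumes "plane_isometry \<phi> G"
  shows "\<phi> \<in> borel_measurable lborel"
proof -
  have "continuous_on UNIV \<phi>"
    unfolding continuous_on_iff using assms plane_isometry_def by metis
  then show ?thesis
    by (simp add: borel_measurable_continuous_onI)
qed

lemma plane_area_eq:
  assumes \<phi>: "plane_isometry \<phi> G"
  shows "plane_area G = distr lborel borel \<phi>"
proof -
  define \<psi> where "\<psi> = (SOME \<phi>. plane_isometry \<phi> G)"
  have \<psi>: "plane_isometry \<psi> G"
    unfolding \<psi>_def by (rule someI[of _ \<phi>]) (rule \<phi>)
  define T where "T x = inv \<psi> (\<phi> x)" for x
  have \<psi>T: "\<psi> (T x) = \<phi> x" for x
    unfolding T_def by (rule f_inv_into_f) (use \<phi> \<psi> in \<open>auto simp: plane_isometry_def\<close>)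
  have T: "dist (T x) (T y) = dist x y" for x y
    using \<phi> \<psi> \<psi>T unfolding plane_isometry_def by metis
  define L where "L x = T x - T 0" for x
  have L: "orthogonal_transformation L"
    unfolding orthogonal_transformation_isometry L_def using T by (simp add: dist_norm)
  have measL: "L \<in> borel_measurable lborel"
    using L by (auto intro!: borel_measurable_continuous_onI linear_continuous_on
        simp: orthogonal_transformation_linear linear_linear)
  have "\<phi> = \<psi> \<circ> (((+) (T 0)) \<circ> L)"
    by (auto simp: fun_eq_iff \<psi>T L_def)
  then have "distr lborel borel \<phi> = distr (distr (distr lborel borel L) borel ((+) (T 0))) borel \<psi>"
    using measL plane_isometry_measurable[OF \<psi>] by (simp add: distr_distr)
  also have "\<dots> = distr lborel borel \<psi>"
    by (simp add: distr_lborel_orthogonal_transformation[OF L] lborel_distr_plus)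
  finally show ?thesis
    by (simp add: plane_area_def \<psi>_def)
qed

end

theory Submission
  imports Defs
begin

text \<open>
  In polar coordinates \<open>(r, \<theta>)\<close> around the centre of the small disk, the part of the circle of
  radius \<open>r\<close> that lies in the large disk is, by the law of cosines, an arc of half-angle
  \<open>arccos ((d\<^sup>2 + r\<^sup>2 - R1\<^sup>2) / (2 * d * r))\<close>, or the whole circle when \<open>r \<le> R1 - d\<close>.
  Integrating out \<open>\<theta>\<close> gives the law of the horizontal distance \<open>r\<close>, and the substitution
  \<open>z = sqrt (r\<^sup>2 + h\<^sup>2)\<close>, for which \<open>z dz = r dr\<close>, turns it into the law of the
  three-dimensional distance.
\<close>


section \<open>The plane as a product of two lines\<close>

lemma Basis_real2: "(Basis :: (real^2) set) = {axis 1 1, axis 2 1}"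
  by (auto simp: Basis_vec_def UNIV_2)

lemma vector_2_eq_axis: "(vector [x, y] :: real^2) = x *\<^sub>R axis 1 1 + y *\<^sub>R axis 2 1"
  by (simp add: vec_eq_iff forall_2 axis_def)

lemma continuous_on_vector_2 [continuous_intros]:
  fixes f g :: "'a::topological_space \<Rightarrow> real"
  assumes "continuous_on S f" "continuous_on S g"
  shows "continuous_on S (\<lambda>x. vector [f x, g x] :: real^2)"
  unfolding vector_2_eq_axis using assms by (intro continuous_intros)

text \<open>Boxes of \<open>real^2\<close> pull back to products of intervals, and boxes determine
  Lebesgue measure. This is the bridge between \<open>real^2\<close>, where the Jacobian formula
  lives, and pairs of reals, where Tonelli applies.\<close>

lemma distr_lborel_vector_2:
  "distr lborel borel (\<lambda>p. vector [fst p, snd p] :: real^2) = lborel"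
proof (rule lborel_eqI[symmetric])
  have meas: "(\<lambda>p. vector [fst p, snd p] :: real^2) \<in> borel_measurable lborel"
    by (simp add: borel_measurable_continuous_onI continuous_intros)
  fix l u :: "real^2"
  assume lu: "\<And>b. b \<in> Basis \<Longrightarrow> l \<bullet> b \<le> u \<bullet> b"
  have lu': "l $ 1 \<le> u $ 1" "l $ 2 \<le> u $ 2"
    using lu[of "axis 1 1"] lu[of "axis 2 1"] by (simp_all add: Basis_real2 inner_axis)
  have "emeasure (distr lborel borel (\<lambda>p. vector [fst p, snd p])) (box l u)
      = emeasure (lborel \<Otimes>\<^sub>M lborel) ({l $ 1<..<u $ 1} \<times> {l $ 2<..<u $ 2})"
    using meas unfolding lborel_prod
    by (subst emeasure_distr) (auto simp: mem_box_cart forall_2 intro!: arg_cong[where f = "emeasure _"])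
  also have "\<dots> = ennreal ((u - l) $ 1 * (u - l) $ 2)"
    using lu' by (subst lborel.emeasure_pair_measure_Times) (auto simp: ennreal_mult)
  also have "(u - l) $ 1 * (u - l) $ 2 = (\<Prod>b\<in>Basis. (u - l) \<bullet> b)"
    by (simp add: Basis_real2 inner_axis axis_eq_axis)
  finally show "emeasure (distr lborel borel (\<lambda>p. vector [fst p, snd p])) (box l u)
      = (\<Prod>b\<in>Basis. (u - l) \<bullet> b)" .
qed simp

section \<open>Polar coordinates\<close>

definition polar :: "real \<Rightarrow> real \<Rightarrow> real^2" where
  "polar r \<theta> = vector [r * cos \<theta>, r * sin \<theta>]"

lemma continuous_on_polar [continuous_intros]:
  fixes f g :: "'a::t2_space \<Rightarrow> real"
  assumes "continuous_on S f" "continuous_on S g"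
  shows "continuous_on S (\<lambda>x. polar (f x) (g x))"
  unfolding polar_def using assms by (intro continuous_intros)

lemma has_derivative_polar:
  "((\<lambda>q. polar (q $ 1) (q $ 2)) has_derivative
    (\<lambda>v. vector [v $ 1 * cos (q $ 2) - q $ 1 * (v $ 2 * sin (q $ 2)),
      v $ 1 * sin (q $ 2) + q $ 1 * (v $ 2 * cos (q $ 2))])) (at q within S)"
  unfolding polar_def vector_2_eq_axis
  by (auto intro!: derivative_eq_intros bounded_linear_vec_nth[THEN bounded_linear_imp_has_derivative]
      simp: fun_eq_iff algebra_simps)

lemma det_matrix_polar:
  "det (matrix (\<lambda>v. vector [v $ 1 * cos \<theta> - r * (v $ 2 * sin \<theta>),
      v $ 1 * sin \<theta> + r * (v $ 2 * cos \<theta>)] :: real^2)) = r"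
proof -
  have "r * (cos \<theta> * cos \<theta>) + r * (sin \<theta> * sin \<theta>) = r"
    by (metis distrib_left mult.right_neutral power2_eq_square sin_cos_squared_add2)
  then show ?thesis
    by (simp add: det_2 matrix_def axis_def algebra_simps)
qed

text \<open>The angle ranges over an open interval, so that the strip is open and the polar map is
  injective on it; the price is a missed half-line.\<close>

definition polar_strip :: "(real^2) set" where
  "polar_strip = {q. 0 < q $ 1 \<and> - pi < q $ 2 \<and> q $ 2 < pi}"

lemma open_polar_strip: "open polar_strip"
  unfolding polar_strip_def by (intro open_Collect_conj open_Collect_less continuous_intros)

lemma Complex_polar: "Complex (polar r \<theta> $ 1) (polar r \<theta> $ 2) = rcis r \<theta>"
  by (simp add: polar_def complex_eq_iff)

text \<open>Read as a complex number, the image point has modulus \<open>r\<close> and, since the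
  angle lies in the range of \<open>Arg\<close>, argument \<open>\<theta>\<close>; so both
  coordinates can be recovered.\<close>

lemma inj_on_polar: "inj_on (\<lambda>q. polar (q $ 1) (q $ 2)) polar_strip"
proof (rule inj_onI)
  fix p q assume p: "p \<in> polar_strip" and q: "q \<in> polar_strip"
    and eq: "polar (p $ 1) (p $ 2) = polar (q $ 1) (q $ 2)"
  have *: "q $ 1 = cmod (rcis (q $ 1) (q $ 2))" "q $ 2 = Arg (rcis (q $ 1) (q $ 2))"
    if "q \<in> polar_strip" for q
    using that by (auto simp: polar_strip_def rcis_def norm_mult cis_conv_exp mult.commute intro!: Arg_unique[symmetric])
  have "rcis (p $ 1) (p $ 2) = rcis (q $ 1) (q $ 2)"
    using eq by (metis Complex_polar)
  then show "p = q"
    using *[OF p] *[OF q] by (simp add: vec_eq_iff forall_2)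
qed

text \<open>The points that are missed are the origin and those of argument \<open>pi\<close>, which
  together form the closed negative half-axis.\<close>

lemma polar_image_strip:
  "(\<lambda>q. polar (q $ 1) (q $ 2)) ` polar_strip = - {x. x $ 1 \<le> 0 \<and> x $ 2 = 0}"
proof (intro equalityI subsetI)
  fix x assume "x \<in> (\<lambda>q. polar (q $ 1) (q $ 2)) ` polar_strip"
  then obtain r \<theta> where r: "x = polar r \<theta>" "0 < r" "- pi < \<theta>" "\<theta> < pi"
    by (auto simp: polar_strip_def)
  then have "Arg (Complex (x $ 1) (x $ 2)) = \<theta>"
    unfolding r(1) Complex_polar
    by (auto simp: rcis_def cis_conv_exp mult.commute intro!: Arg_unique)
  moreover have "Complex (x $ 1) (x $ 2) \<noteq> 0"
    unfolding r(1) Complex_polar using r by (simp add: rcis_def)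
  ultimately show "x \<in> - {x. x $ 1 \<le> 0 \<and> x $ 2 = 0}"
    using Arg_eq_pi[of "Complex (x $ 1) (x $ 2)"] r
    by (auto simp: complex_eq_iff)
next
  fix x :: "real^2" assume x: "x \<in> - {x. x $ 1 \<le> 0 \<and> x $ 2 = 0}"
  define z where "z = Complex (x $ 1) (x $ 2)"
  have "z \<noteq> 0" "Arg z \<noteq> pi"
    using x by (auto simp: z_def complex_eq_iff Arg_eq_pi)
  moreover have "- pi < Arg z" "Arg z \<le> pi"
    using Arg_bounded[of z] by auto
  ultimately have "vector [cmod z, Arg z] \<in> polar_strip"
    by (simp add: polar_strip_def)
  moreover have "x = polar (cmod z) (Arg z)"
    using rcis_cmod_Arg[of z] Complex_polar[of "cmod z" "Arg z"]
    by (simp add: z_def vec_eq_iff forall_2)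
  ultimately show "x \<in> (\<lambda>q. polar (q $ 1) (q $ 2)) ` polar_strip"
    by (intro image_eqI[of _ _ "vector [cmod z, Arg z]"]) auto
qed

text \<open>Change of variables with Jacobian \<open>r\<close>, checked on boxes. The half-line
  outside the image of the strip is a null set and does not affect areas.\<close>

lemma distr_polar:
  "distr (density lborel (\<lambda>q. ennreal (indicator polar_strip q * q $ 1))) borel
    (\<lambda>q. polar (q $ 1) (q $ 2)) = lborel"
proof (rule lborel_eqI[symmetric])
  let ?P = "\<lambda>q :: real^2. polar (q $ 1) (q $ 2)"
  have [measurable]: "?P \<in> borel_measurable borel"
    by (intro borel_measurable_continuous_onI continuous_intros)
  have [measurable]: "polar_strip \<in> sets borel" "(\<lambda>q :: real^2. q $ 1) \<in> borel_measurable borel"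
    using open_polar_strip by (auto intro!: borel_measurable_continuous_onI continuous_intros)
  fix l u :: "real^2"
  assume lu: "\<And>b. b \<in> Basis \<Longrightarrow> l \<bullet> b \<le> u \<bullet> b"
  define T where "T = polar_strip \<inter> ?P -` box l u"
  have T[measurable]: "T \<in> sets borel"
    unfolding T_def by (intro sets.Int measurable_sets_borel[OF _ borel_open]) auto
  define N :: "(real^2) set" where "N = {x. x $ 1 \<le> 0 \<and> x $ 2 = 0}"
  have N: "negligible N"
    by (rule negligible_subset[OF negligible_standard_hyperplane_cart[of 2]]) (auto simp: N_def)
  have image: "?P ` T = box l u - N"
  proof -
    have "f ` (A \<inter> f -` B) = f ` A \<inter> B" for f :: "real^2 \<Rightarrow> real^2" and A B
      by blast
    then have "?P ` T = ?P ` polar_strip \<inter> box l u"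
      unfolding T_def .
    also have "\<dots> = box l u - N"
      unfolding polar_image_strip N_def by (simp add: Diff_eq Int_commute)
    finally show ?thesis .
  qed
  have lm: "?P ` T \<in> lmeasurable"
    unfolding image using N by (simp add: fmeasurable.Diff negligible_imp_measurable)
  let ?D = "\<lambda>q v :: real^2. vector [v $ 1 * cos (q $ 2) - q $ 1 * (v $ 2 * sin (q $ 2)),
      v $ 1 * sin (q $ 2) + q $ 1 * (v $ 2 * cos (q $ 2))] :: real^2"
  have det: "\<bar>det (matrix (?D q))\<bar> = q $ 1" if "q \<in> T" for q
    using that by (simp add: det_matrix_polar T_def polar_strip_def)
  have inj: "inj_on ?P T"
    using inj_on_polar by (rule inj_on_subset) (simp add: T_def)
  have Tleb: "T \<in> sets lebesgue" using T by simp
  \<comment> \<open>Finite measure of the image is equivalent to integrability of the Jacobian. The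
    image is a box minus a null set, so the equivalence yields integrability.\<close>
  have int_det: "(\<lambda>q. \<bar>det (matrix (?D q))\<bar>) integrable_on T"
    using measurable_differentiable_image_eq[OF Tleb has_derivative_polar inj] lm by (rule iffD1)
  have int: "(\<lambda>q. q $ 1) integrable_on T"
    using int_det by (rule integrable_eq) (rule det)
  have "measure lebesgue (?P ` T) = integral T (\<lambda>q. \<bar>det (matrix (?D q))\<bar>)"
    using measure_differentiable_image_eq[OF Tleb has_derivative_polar inj int_det] .
  also have "\<dots> = integral T (\<lambda>q. q $ 1)"
    by (rule integral_cong) (rule det)
  finally have integral_T: "integral T (\<lambda>q. q $ 1) = measure lebesgue (?P ` T)" ..
  have "emeasure (distr (density lborel (\<lambda>q. ennreal (indicator polar_strip q * q $ 1))) borel ?P) (box l u)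
      = (\<integral>\<^sup>+q. ennreal (indicator T q * q $ 1) \<partial>lborel)"
  proof -
    have "?P -` box l u \<in> sets borel"
      by (rule measurable_sets_borel[of _ borel]) auto
    then show ?thesis
      by (auto simp: emeasure_distr emeasure_density T_def intro!: nn_integral_cong split: split_indicator)
  qed
  also have "\<dots> = ennreal (integral T (\<lambda>q. q $ 1))"
    using int by (intro nn_integral_has_integral_lebesgue) (auto simp: T_def polar_strip_def integrable_integral)
  also have "\<dots> = ennreal (measure lebesgue (box l u))"
    unfolding integral_T image using N by (simp add: measure_Diff_null_set negligible_iff_null_sets)
  also have "\<dots> = (\<Prod>b\<in>Basis. (u - l) \<bullet> b)"
    using lu by (simp add: measure_lborel_box_eq)
  finally show "emeasure (distr (density lborel (\<lambda>q. ennreal (indicator polar_strip q * q $ 1))) borel ?P)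
    (box l u) = (\<Prod>b\<in>Basis. (u - l) \<bullet> b)" .
qed simp

text \<open>Pull the integral back along \<open>distr_polar\<close>, pass to pairs by
  \<open>distr_lborel_vector_2\<close>, then apply Tonelli with the angle as inner variable. The
  indicators encode the strip.\<close>

lemma nn_integral_polar:
  fixes f :: "real^2 \<Rightarrow> ennreal"
  assumes [measurable]: "f \<in> borel_measurable borel"
  shows "(\<integral>\<^sup>+x. f x \<partial>lborel) =
    (\<integral>\<^sup>+r. (\<integral>\<^sup>+\<theta>. f (polar r \<theta>) * indicator {- pi<..<pi} \<theta> \<partial>lborel) * ennreal r * indicator {0<..} r \<partial>lborel)"
proof -
  let ?P = "\<lambda>q :: real^2. polar (q $ 1) (q $ 2)"
  have [measurable]: "?P \<in> borel_measurable borel" "case_prod polar \<in> borel_measurable (lborel \<Otimes>\<^sub>M lborel)"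
    by (auto simp: case_prod_beta lborel_prod intro!: borel_measurable_continuous_onI continuous_intros)
  have [measurable]: "polar_strip \<in> sets borel" "(\<lambda>q :: real^2. q $ 1) \<in> borel_measurable borel"
    using open_polar_strip by (auto intro!: borel_measurable_continuous_onI continuous_intros)
  have [measurable]: "(\<lambda>p. vector [fst p, snd p] :: real^2) \<in> borel_measurable borel"
    by (intro borel_measurable_continuous_onI continuous_intros)
  have [measurable]: "polar r \<in> borel_measurable borel" for r
    by (intro borel_measurable_continuous_onI continuous_intros)
  let ?g = "\<lambda>(r, \<theta>). f (polar r \<theta>) * indicator {- pi<..<pi} \<theta> * ennreal r * indicator {0<..} r"
  have [measurable]: "?g \<in> borel_measurable (lborel \<Otimes>\<^sub>M lborel)"
    by measurable
  have "(\<integral>\<^sup>+x. f x \<partial>lborel) = (\<integral>\<^sup>+q. ennreal (indicator polar_strip q * q $ 1) * f (?P q) \<partial>lborel)"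
    by (subst distr_polar[symmetric]) (simp add: nn_integral_distr nn_integral_density)
  also have "\<dots> = (\<integral>\<^sup>+p. ?g p \<partial>lborel)"
    by (subst distr_lborel_vector_2[symmetric])
      (auto simp: nn_integral_distr polar_strip_def mult_ac intro!: nn_integral_cong split: split_indicator)
  also have "\<dots> = (\<integral>\<^sup>+r. \<integral>\<^sup>+\<theta>. ?g (r, \<theta>) \<partial>lborel \<partial>lborel)"
    unfolding lborel_prod[symmetric] by (rule lborel.nn_integral_fst[symmetric]) measurable
  also have "\<dots> = (\<integral>\<^sup>+r. (\<integral>\<^sup>+\<theta>. f (polar r \<theta>) * indicator {- pi<..<pi} \<theta> \<partial>lborel) * ennreal r * indicator {0<..} r \<partial>lborel)"
    by (intro nn_integral_cong) (simp add: nn_integral_multc)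
  finally show ?thesis .
qed


text \<open>Outside \<open>{-1..1}\<close>, \<open>arccos\<close> is \<open>THE\<close> of an empty predicate, hence constant there.\<close>

lemma borel_measurable_arccos [measurable]: "(arccos :: real \<Rightarrow> real) \<in> borel_measurable borel"
proof -
  have "arccos y = (if y \<in> {-1..1} then arccos y else arccos 2)" for y :: real
  proof (cases "y \<in> {-1..1}")
    case False
    then have "y < - 1 \<or> 1 < y" by auto
    then have "cos x \<noteq> y" "cos x \<noteq> 2" for x
      using cos_ge_minus_one[of x] cos_le_one[of x] by linarith+
    then show ?thesis
      using False unfolding arccos_def by simp
  qed simp
  moreover have "(\<lambda>y :: real. if y \<in> {-1..1} then arccos y else arccos 2) \<in> borel_measurable borel"
    by (intro borel_measurable_continuous_on_if continuous_on_arccos') auto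
  ultimately show ?thesis
    by presburger
qed

section \<open>Arcs of circles inside a disk\<close>

lemma norm_polar: "norm (polar r \<theta>) = \<bar>r\<bar>"
proof -
  have "(r * cos \<theta>)\<^sup>2 + (r * sin \<theta>)\<^sup>2 = r\<^sup>2"
    using sin_cos_squared_add[of \<theta>] by (simp add: power_mult_distrib flip: distrib_left)
  then show ?thesis
    by (simp add: norm_vec_def L2_set_def sum_2 polar_def)
qed

lemma norm_vector_2_0: "norm (vector [d, 0] :: real^2) = \<bar>d\<bar>"
  using norm_polar[of d 0] by (simp add: polar_def)

text \<open>The law of cosines in the triangle formed by the origin, the point \<open>(d, 0)\<close>
  and the point at radius \<open>r\<close>.\<close>

lemma dist_polar_square: "(dist (vector [d, 0]) (polar r \<theta>))\<^sup>2 = d\<^sup>2 + r\<^sup>2 - 2 * d * r * cos \<theta>"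
proof -
  have "vector [d, 0] \<bullet> polar r \<theta> = d * r * cos \<theta>"
    by (simp add: inner_vec_def sum_2 polar_def)
  then show ?thesis
    using dot_norm_neg[of "vector [d, 0]" "polar r \<theta>"]
    by (simp add: dist_norm norm_polar norm_vector_2_0)
qed

text \<open>The cases are: circle inside the disk, circle crossing its boundary, circle outside. For
  positive \<open>d\<close> and \<open>r\<close>, the quotient is below -1 when
  \<open>r < R - d\<close> and above 1 when \<open>r > R + d\<close>, so \<open>arccos\<close> needs
  the case split.\<close>

definition half_angle :: "real \<Rightarrow> real \<Rightarrow> real \<Rightarrow> real" where
  "half_angle R d r = (if r \<le> R - d then pi else if r \<le> R + d
     then arccos ((d\<^sup>2 + r\<^sup>2 - R\<^sup>2) / (2 * d * r)) else 0)"

text \<open>By the law of cosines, membership in the disk is a lower bound on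
  \<open>cos \<theta>\<close>, hence an upper bound on the absolute value of
  \<open>\<theta>\<close>. When the circle does not cross the boundary, the triangle inequality
  decides.\<close>

lemma emeasure_arc:
  assumes "0 < d" "d < R" "0 < r"
  shows "emeasure lborel {\<theta> \<in> {- pi<..<pi}. polar r \<theta> \<in> cball (vector [d, 0]) R}
    = ennreal (2 * half_angle R d r)"
proof -
  let ?D = "{\<theta> \<in> {- pi<..<pi}. polar r \<theta> \<in> cball (vector [d, 0]) R}"
  have tri: "r - d \<le> dist (vector [d, 0]) (polar r \<theta>)" "dist (vector [d, 0]) (polar r \<theta>) \<le> r + d" for \<theta>
    using norm_triangle_ineq2[of "polar r \<theta>" "vector [d, 0]"]
      norm_triangle_ineq4[of "polar r \<theta>" "vector [d, 0]"] assms
    by (auto simp: dist_norm norm_minus_commute norm_polar norm_vector_2_0)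
  consider "r \<le> R - d" | "R - d < r" "r \<le> R + d" | "R + d < r" by linarith
  then show ?thesis
  proof cases
    case 1
    then have "?D = {- pi<..<pi}"
      using tri(2) by (force intro: order_trans)
    then show ?thesis
      using 1 by (simp add: half_angle_def)
  next
    case 3
    have "?D = {}"
    proof (rule equals0I)
      fix \<theta> assume "\<theta> \<in> ?D"
      then show False using 3 tri(1)[of \<theta>] by simp
    qed
    then have "emeasure lborel ?D = 0"
      by (simp only: emeasure_empty)
    then show ?thesis
      using 3 assms by (simp add: half_angle_def)
  next
    case 2
    define c where "c = (d\<^sup>2 + r\<^sup>2 - R\<^sup>2) / (2 * d * r)"
    \<comment> \<open>The first inequality amounts to \<open>c \<le> 1\<close>, the second to
      \<open>- 1 \<le> c\<close>.\<close>
    have "(r - d)\<^sup>2 \<le> R\<^sup>2" "R\<^sup>2 \<le> (r + d)\<^sup>2"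
      using 2 assms by (auto intro!: power_mono simp flip: abs_le_square_iff)
    then have c: "- 1 \<le> c" "c \<le> 1"
      using assms by (auto simp: c_def field_simps power2_eq_square)
    have iff: "polar r \<theta> \<in> cball (vector [d, 0]) R \<longleftrightarrow> \<bar>\<theta>\<bar> \<le> arccos c" if "\<bar>\<theta>\<bar> \<le> pi" for \<theta>
    proof -
      have "polar r \<theta> \<in> cball (vector [d, 0]) R \<longleftrightarrow> (dist (vector [d, 0]) (polar r \<theta>))\<^sup>2 \<le> R\<^sup>2"
        using assms by (simp add: power2_le_iff_abs_le)
      \<comment> \<open>The absolute value moves the angle into \<open>[0, pi]\<close>, where cosine
        is decreasing.\<close>
      also have "\<dots> \<longleftrightarrow> cos (arccos c) \<le> cos \<bar>\<theta>\<bar>"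
        unfolding dist_polar_square using assms c by (simp add: c_def field_simps)
      also have "\<dots> \<longleftrightarrow> \<bar>\<theta>\<bar> \<le> arccos c"
        using that c arccos_bounded[of c] by (intro cos_mono_le_eq) auto
      finally show ?thesis .
    qed
    have "0 \<le> arccos c" "arccos c \<le> pi" using c arccos_bounded by auto
    \<comment> \<open>For \<open>arccos c = pi\<close> the closed interval would exceed the open
      range of angles by its endpoints. Either interval has length
      \<open>2 * arccos c\<close>.\<close>
    then have "?D = (if arccos c = pi then {- pi<..<pi} else {- arccos c..arccos c})"
      using iff by (auto simp: abs_le_iff)
    then show ?thesis
      using 2 assms \<open>0 \<le> arccos c\<close> by (auto simp: half_angle_def c_def)
  qed
qed

section \<open>From horizontal distance to slant distance\<close>

definition slant_density :: "real \<Rightarrow> real \<Rightarrow> real \<Rightarrow> real \<Rightarrow> real \<Rightarrow> real" where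
  "slant_density R1 R2 d h z =
    (if sqrt (R2\<^sup>2 + h\<^sup>2) \<le> z \<and> z \<le> sqrt ((R1 - d)\<^sup>2 + h\<^sup>2)
       then 2 * z / (R1\<^sup>2 - R2\<^sup>2)
     else if sqrt ((R1 - d)\<^sup>2 + h\<^sup>2) < z \<and> z \<le> sqrt ((R1 + d)\<^sup>2 + h\<^sup>2)
       then 2 * z * omega_hat R1 d h z / (pi * (R1\<^sup>2 - R2\<^sup>2))
     else 0)"

lemma borel_measurable_slant_density [measurable]:
  "slant_density R1 R2 d h \<in> borel_measurable borel"
  unfolding slant_density_def omega_hat_def arcsec_def by measurable

text \<open>The substitution \<open>z = sqrt (r\<^sup>2 + h\<^sup>2)\<close> turns
  \<open>omega_hat\<close> into the half-angle. On the first range the half-angle is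
  \<open>pi\<close>, which accounts for the absence of \<open>pi\<close> in that branch of the
  density.\<close>

lemma slant_density_sqrt:
  assumes "0 < d" "0 < h" "0 < R2" "d + R2 \<le> R1" "R2 \<le> r" "r \<le> R1 + d"
  shows "pi * (R1\<^sup>2 - R2\<^sup>2) * slant_density R1 R2 d h (sqrt (r\<^sup>2 + h\<^sup>2))
    = 2 * sqrt (r\<^sup>2 + h\<^sup>2) * half_angle R1 d r"
proof -
  have mono: "sqrt (a\<^sup>2 + h\<^sup>2) \<le> sqrt (b\<^sup>2 + h\<^sup>2) \<longleftrightarrow> a \<le> b" if "0 \<le> a" "0 \<le> b" for a b
    using that by (simp add: abs_le_square_iff[symmetric])
  have "R2\<^sup>2 < R1\<^sup>2"
    using assms by (intro power_strict_mono) auto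
  then have pos: "R1\<^sup>2 - R2\<^sup>2 \<noteq> 0" by simp
  \<comment> \<open>The reciprocal in \<open>arcsec\<close> inverts the quotient. If its denominator
    vanishes, both sides are \<open>arccos 0\<close>.\<close>
  have \<omega>: "omega_hat R1 d h (sqrt (r\<^sup>2 + h\<^sup>2)) = arccos ((d\<^sup>2 + r\<^sup>2 - R1\<^sup>2) / (2 * d * r))"
    using assms by (simp add: omega_hat_def arcsec_def)
  show ?thesis
    using assms pos mono[of R2 r] mono[of r "R1 - d"] mono[of r "R1 + d"]
    by (auto simp: slant_density_def half_angle_def \<omega> not_le[symmetric])
qed

text \<open>Polar coordinates give the area element \<open>2 * half_angle R1 d r * r\<close> in
  \<open>r\<close>, and \<open>z dz = r dr\<close> converts it to \<open>z\<close>. The factor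
  \<open>pi * (R1\<^sup>2 - R2\<^sup>2)\<close> is the area of the region, so the normalization is
  left for later.\<close>

lemma emeasure_slant_distance:
  fixes B :: "real set"
  assumes "0 < d" "0 < h" "0 < R2" "d + R2 \<le> R1" and [measurable]: "B \<in> sets borel"
  shows "emeasure lborel ((cball (vector [d, 0]) R1 - cball 0 R2) \<inter> {x :: real^2. sqrt ((norm x)\<^sup>2 + h\<^sup>2) \<in> B})
    = (\<integral>\<^sup>+z. ennreal (pi * (R1\<^sup>2 - R2\<^sup>2)) * (ennreal (slant_density R1 R2 d h z) * indicator B z) \<partial>lborel)"
proof -
  define c :: "real^2" where "c = vector [d, 0]"
  define g where "g r = sqrt (r\<^sup>2 + h\<^sup>2)" for r
  define C where "C = pi * (R1\<^sup>2 - R2\<^sup>2)"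
  let ?S = "(cball c R1 - cball 0 R2) \<inter> {x. g (norm x) \<in> B}"
  let ?F = "\<lambda>z. C * slant_density R1 R2 d h z * indicator B z"
  have "R2\<^sup>2 < R1\<^sup>2"
    using assms by (intro power_strict_mono) auto
  then have C: "0 \<le> C" by (simp add: C_def)
  have g_pos: "0 < g r" for r
    unfolding g_def using assms by (simp add: add_nonneg_pos)
  have g_mono: "g a \<le> g b \<longleftrightarrow> a \<le> b" if "0 \<le> a" "0 \<le> b" for a b
    using that by (simp add: g_def abs_le_square_iff[symmetric])
  have [measurable]: "g \<in> borel_measurable borel"
    unfolding g_def by measurable
  have [measurable]: "polar r \<in> borel_measurable borel" for r
    by (intro borel_measurable_continuous_onI continuous_intros)
  have [measurable]: "?S \<in> sets borel"
    by measurable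
  have arc: "(\<integral>\<^sup>+\<theta>. indicator ?S (polar r \<theta>) * indicator {- pi<..<pi} \<theta> \<partial>lborel)
      = ennreal (2 * half_angle R1 d r) * indicator {R2<..} r * indicator B (g r)" if "0 < r" for r
  proof -
    \<comment> \<open>Since \<open>polar r \<theta>\<close> has norm \<open>r\<close>, only
      membership in the large disk depends on the angle; the other conditions factor out.\<close>
    have "(\<integral>\<^sup>+\<theta>. indicator ?S (polar r \<theta>) * indicator {- pi<..<pi} \<theta> \<partial>lborel)
       = (\<integral>\<^sup>+\<theta>. indicator {\<theta> \<in> {- pi<..<pi}. polar r \<theta> \<in> cball c R1} \<theta> *
           (indicator {R2<..} r * indicator B (g r)) \<partial>lborel)"
      using that by (intro nn_integral_cong) (auto simp: norm_polar split: split_indicator)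
    also have "\<dots> = emeasure lborel {\<theta> \<in> {- pi<..<pi}. polar r \<theta> \<in> cball c R1} * (indicator {R2<..} r * indicator B (g r))"
    proof -
      have "{- pi<..<pi} \<inter> polar r -` cball c R1 \<in> sets borel"
        by (intro sets.Int measurable_sets_borel[of _ borel]) auto
      then have "{\<theta> \<in> {- pi<..<pi}. polar r \<theta> \<in> cball c R1} \<in> sets lborel"
        by (simp add: vimage_def Int_def)
      then show ?thesis
        by (simp only: nn_integral_multc nn_integral_indicator borel_measurable_indicator)
    qed
    also have "\<dots> = ennreal (2 * half_angle R1 d r) * (indicator {R2<..} r * indicator B (g r))"
      unfolding c_def using assms that by (subst emeasure_arc) auto
    finally show ?thesis by (simp add: mult.assoc)
  qed
  have "emeasure lborel ?S = (\<integral>\<^sup>+x. indicator ?S x \<partial>lborel)"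
    by simp
  also have "\<dots> = (\<integral>\<^sup>+r. ennreal (2 * half_angle R1 d r) * indicator {R2<..} r * indicator B (g r)
      * ennreal r * indicator {0<..} r \<partial>lborel)"
    by (subst nn_integral_polar) (auto simp: arc intro!: nn_integral_cong split: split_indicator)
  also have "\<dots> = (\<integral>\<^sup>+r. ennreal (?F (g r) * (r / g r) * indicator {R2..R1 + d} r) \<partial>lborel)"
  proof (rule nn_integral_cong_AE)
    \<comment> \<open>The removed disk is closed, so the left side vanishes at
      \<open>r = R2\<close>, while the closed interval required for the substitution contains this
      point.\<close>
    have "AE r in lborel. r \<noteq> R2" by (rule AE_lborel_singleton)
    then show "AE r in lborel. ennreal (2 * half_angle R1 d r) * indicator {R2<..} r * indicator B (g r)
        * ennreal r * indicator {0<..} r = ennreal (?F (g r) * (r / g r) * indicator {R2..R1 + d} r)"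
    proof eventually_elim
      case (elim r)
      show ?case
      proof (cases "R2 < r \<and> r \<le> R1 + d")
        case True
        then have "C * slant_density R1 R2 d h (g r) = 2 * g r * half_angle R1 d r"
          using assms unfolding C_def g_def by (intro slant_density_sqrt) auto
        then show ?thesis
          using True assms g_pos[of r]
          by (auto simp: ennreal_mult''[symmetric] mult.assoc split: split_indicator)
      next
        case False
        then show ?thesis
          using elim assms by (auto simp: half_angle_def split: split_indicator)
      qed
    qed
  qed
  also have "\<dots> = (\<integral>\<^sup>+z. ennreal (?F z * indicator {g R2..g (R1 + d)} z) \<partial>lborel)"
  \<comment> \<open>The substitution is \<open>z = g r\<close>, whose derivative
    \<open>r / g r\<close> is nonnegative on the interval.\<close>
  proof (rule nn_integral_substitution[symmetric])
    show "set_borel_measurable borel {g R2..g (R1 + d)} ?F"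
      unfolding set_borel_measurable_def by measurable
    show "(g has_real_derivative r / g r) (at r)" for r
      using g_pos[of r] unfolding g_def
      by (auto intro!: derivative_eq_intros simp: field_simps)
    show "continuous_on {R2..R1 + d} (\<lambda>r. r / g r)"
      using g_pos unfolding g_def by (intro continuous_intros) (metis less_irrefl)
    show "0 \<le> r / g r" if "r \<in> {R2..R1 + d}" for r
      using that assms g_pos[of r] by simp
  qed (use assms in auto)
  also have "\<dots> = (\<integral>\<^sup>+z. ennreal C * (ennreal (slant_density R1 R2 d h z) * indicator B z) \<partial>lborel)"
  proof (rule nn_integral_cong)
    fix z
    have g_le: "g R2 \<le> g (R1 - d)" "g (R1 - d) \<le> g (R1 + d)"
      using g_mono assms by auto
    have support: "slant_density R1 R2 d h z * indicator {g R2..g (R1 + d)} z = slant_density R1 R2 d h z"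
      using g_le unfolding slant_density_def g_def[symmetric] by (auto split: split_indicator)
    have "?F z * indicator {g R2..g (R1 + d)} z
        = C * ((slant_density R1 R2 d h z * indicator {g R2..g (R1 + d)} z) * indicator B z)"
      by (simp only: mult_ac)
    then have F_eq: "?F z * indicator {g R2..g (R1 + d)} z = C * (slant_density R1 R2 d h z * indicator B z)"
      by (simp only: support)
    show "ennreal (?F z * indicator {g R2..g (R1 + d)} z)
        = ennreal C * (ennreal (slant_density R1 R2 d h z) * indicator B z)"
      unfolding F_eq using C by (simp only: ennreal_mult' ennreal_mult'' indicator_pos_le ennreal_indicator)
  qed
  finally show ?thesis
    unfolding c_def g_def C_def .
qed

section \<open>Coordinates on the ground plane and the law of the distance\<close>

text \<open>Precompose arbitrary coordinates with a translation and an orthogonal map. The latter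
  exists because \<open>(dist c1 c2, 0)\<close> and the difference of the coordinates of the centers
  have the same norm. This places the disks as in \<open>emeasure_slant_distance\<close>.\<close>

lemma plane_isometry_exists_axis:
  assumes "affine G" "aff_dim G = 2" "c1 \<in> G" "c2 \<in> G"
  obtains \<phi> where "plane_isometry \<phi> G" "\<phi> 0 = c2" "\<phi> (vector [dist c1 c2, 0]) = c1"
proof -
  obtain \<psi> where \<psi>: "plane_isometry \<psi> G"
    using plane_isometry_exists assms by blast
  then obtain a b where ab: "\<psi> a = c2" "\<psi> b = c1"
    using assms unfolding plane_isometry_def by (metis imageE)
  have "norm (vector [dist c1 c2, 0] :: real^2) = norm (b - a)"
    using \<psi> ab unfolding plane_isometry_def norm_vector_2_0 by (metis abs_of_nonneg dist_norm zero_le_dist)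
  then obtain L :: "real^2 \<Rightarrow> real^2" where L: "orthogonal_transformation L" "L (vector [dist c1 c2, 0]) = b - a"
    by (rule orthogonal_transformation_exists)
  have "L 0 = 0"
    using L(1) by (simp add: linear_0 orthogonal_transformation_linear)
  moreover have "dist (L x) (L y) = dist x y" for x y
    using L(1) by (simp add: orthogonal_transformation_isometry)
  moreover have "range (\<lambda>x. a + L x) = UNIV"
    using orthogonal_transformation_surj[OF L(1)]
    by (metis surj_def add_diff_cancel_left' diff_add_cancel add.commute)
  then have "range (\<lambda>x. \<psi> (a + L x)) = range \<psi>"
    by (metis image_image)
  ultimately show thesis
    using \<psi> ab L(2) by (intro that[of "\<lambda>x. \<psi> (a + L x)"]) (auto simp: plane_isometry_def)
qed


theorem lemma4:
  fixes M :: "'m measure"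
    and G :: "(real^3) set"
    and n c1 c2 :: "real^3"
    and R1 R2 d h :: real
    and U :: "'m \<Rightarrow> real^3"
  assumes "prob_space M"
    and "affine G" and "aff_dim G = 2"
    and "norm n = 1" and "\<forall>x\<in>G. \<forall>y\<in>G. orthogonal n (x - y)"
    and "c1 \<in> G" and "c2 \<in> G" and "dist c1 c2 = d"
    and "R2 > 0" and "d > 0" and "h > 0" and "d + R2 \<le> R1"
    and "disk_in G c2 R2 \<subseteq> disk_in G c1 R1"
    and "uniformly_distributed_in_plane M G U (disk_in G c1 R1 - disk_in G c2 R2)"
  shows "distributed M lborel (\<lambda>\<omega>. dist (c2 + h *\<^sub>R n) (U \<omega>))
    (\<lambda>z. ennreal
      (if sqrt (R2\<^sup>2 + h\<^sup>2) \<le> z \<and> z \<le> sqrt ((R1 - d)\<^sup>2 + h\<^sup>2)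
         then 2 * z / (R1\<^sup>2 - R2\<^sup>2)
       else if sqrt ((R1 - d)\<^sup>2 + h\<^sup>2) < z \<and> z \<le> sqrt ((R1 + d)\<^sup>2 + h\<^sup>2)
         then 2 * z * omega_hat R1 d h z / (pi * (R1\<^sup>2 - R2\<^sup>2))
       else 0))"
proof -
  obtain \<phi> where \<phi>: "plane_isometry \<phi> G" and c2: "\<phi> 0 = c2" and c1: "\<phi> (vector [d, 0]) = c1"
    using plane_isometry_exists_axis[of G c1 c2] assms by metis
  have iso: "dist (\<phi> x) (\<phi> y) = dist x y" and ran: "\<phi> x \<in> G" for x y
    using \<phi> by (auto simp: plane_isometry_def)
  define A where "A = disk_in G c1 R1 - disk_in G c2 R2"
  define S :: "(real^2) set" where "S = cball (vector [d, 0]) R1 - cball 0 R2"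
  define Z where "Z = (\<lambda>x. dist (c2 + h *\<^sub>R n) x)"
  define C where "C = pi * (R1\<^sup>2 - R2\<^sup>2)"
  have U[measurable]: "U \<in> borel_measurable M"
    and distr_U: "distr M borel U = uniform_measure (plane_area G) A"
    using assms(14) by (simp_all add: uniformly_distributed_in_plane_def A_def)
  have [measurable]: "\<phi> \<in> borel_measurable borel"
    using plane_isometry_measurable[OF \<phi>] by simp
  have [measurable]: "Z \<in> borel_measurable borel"
    unfolding Z_def by measurable
  \<comment> \<open>Closedness makes disks of the plane Borel in the ambient space, on whose Borel
    sets \<open>plane_area\<close> lives.\<close>
  have "closed G"
    using assms(2) by (rule affine_closed)
  then have [measurable]: "disk_in G c R \<in> sets borel" for c R
    using borel_closed[of "G \<inter> cball c R"] by (simp add: disk_in_def cball_def Int_def)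
  have A[measurable]: "A \<in> sets borel"
    unfolding A_def by measurable
  have area: "plane_area G = distr lborel borel \<phi>"
    using \<phi> by (rule plane_area_eq)
  have vimage_A: "\<phi> -` A = S"
    by (auto simp: A_def S_def disk_in_def ran iso simp flip: c1 c2)
  have Z_\<phi>: "Z (\<phi> x) = sqrt ((norm x)\<^sup>2 + h\<^sup>2)" for x
  proof -
    \<comment> \<open>The second vector joins two points of the plane, so Pythagoras splits the
      distance into height and horizontal part.\<close>
    have "orthogonal (h *\<^sub>R n) (c2 - \<phi> x)"
      using assms(5,7) ran[of x] by (simp add: orthogonal_clauses)
    then have "(norm (h *\<^sub>R n + (c2 - \<phi> x)))\<^sup>2 = (norm (h *\<^sub>R n))\<^sup>2 + (norm (c2 - \<phi> x))\<^sup>2"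
      by (rule norm_add_Pythagorean)
    moreover have "norm (c2 - \<phi> x) = norm x"
      using iso[of 0 x] by (simp add: c2 dist_norm)
    ultimately have "(Z (\<phi> x))\<^sup>2 = (norm x)\<^sup>2 + h\<^sup>2"
      using assms(4) by (simp add: Z_def dist_norm algebra_simps)
    then show ?thesis
      by (metis Z_def real_sqrt_unique zero_le_dist)
  qed
  have "R2\<^sup>2 < R1\<^sup>2"
    using assms by (intro power_strict_mono) auto
  then have C: "0 < C" by (simp add: C_def)
  \<comment> \<open>By this inclusion the areas of the two disks subtract, giving the normalizing
    constant.\<close>
  have "cball 0 R2 \<subseteq> cball (vector [d, 0] :: real^2) R1"
    using assms by (simp add: cball_subset_cball_iff dist_norm norm_vector_2_0)
  then have "emeasure lborel S = emeasure lborel (cball (vector [d, 0] :: real^2) R1) - emeasure lborel (cball (0 :: real^2) R2)"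
    unfolding S_def using emeasure_lborel_cball_finite[of "0 :: real^2" R2]
    by (intro emeasure_Diff) auto
  also have "\<dots> = ennreal C"
    using assms by (simp add: emeasure_cball eval_unit_ball_vol ennreal_minus C_def algebra_simps power2_eq_square)
  finally have area_A: "emeasure (plane_area G) A = ennreal C"
    by (simp add: area emeasure_distr vimage_A)
  have "distr M lborel (\<lambda>\<omega>. Z (U \<omega>)) = density lborel (slant_density R1 R2 d h)"
  proof (rule measure_eqI)
    fix B assume "B \<in> sets (distr M lborel (\<lambda>\<omega>. Z (U \<omega>)))"
    then have [measurable]: "B \<in> sets borel" by simp
    have ZB: "Z -` B \<in> sets borel"
      by (rule measurable_sets_borel[of Z borel]) measurable
    have "emeasure (distr M lborel (\<lambda>\<omega>. Z (U \<omega>))) B = emeasure (distr M borel U) (Z -` B)"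
      by (simp add: emeasure_distr vimage_def)
    also have "\<dots> = emeasure (plane_area G) (A \<inter> Z -` B) / ennreal C"
      unfolding distr_U area_A[symmetric] by (intro emeasure_uniform_measure) (auto simp: area ZB)
    also have "emeasure (plane_area G) (A \<inter> Z -` B) = emeasure lborel (S \<inter> {x. sqrt ((norm x)\<^sup>2 + h\<^sup>2) \<in> B})"
      unfolding vimage_A[symmetric] by (auto simp: area emeasure_distr ZB Z_\<phi> intro!: arg_cong[where f = "emeasure _"])
    also have "\<dots> = ennreal C * (\<integral>\<^sup>+z. ennreal (slant_density R1 R2 d h z) * indicator B z \<partial>lborel)"
      unfolding S_def C_def using assms
      by (subst emeasure_slant_distance) (auto simp: nn_integral_cmult)
    \<comment> \<open>Cancellation in \<open>ennreal\<close> is legitimate because the area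
      \<open>C\<close> is positive and finite.\<close>
    also have "\<dots> / ennreal C = emeasure (density lborel (slant_density R1 R2 d h)) B"
      using C mult_divide_eq_ennreal[of "ennreal C"] by (simp add: emeasure_density mult.commute[of "ennreal C"])
    finally show "emeasure (distr M lborel (\<lambda>\<omega>. Z (U \<omega>))) B
      = emeasure (density lborel (slant_density R1 R2 d h)) B" .
  qed simp
  then have "distributed M lborel (\<lambda>\<omega>. Z (U \<omega>)) (\<lambda>z. ennreal (slant_density R1 R2 d h z))"
    by (simp add: distributed_def)
  then show ?thesis
    by (simp only: Z_def slant_density_def)
qed

end
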